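(* Let $X=[\ell,u]\subseteq\mathbb{R}^n$ be a box with $\ell_i<u_i$ for all $i$, and let $g:\mathbb{R}^n\to\mathbb{R}$ and $h:\mathbb{R}^n\to\mathbb{R}$ be convex functions. Assume $\epsilon=0$ in Algorithm 3 (defined in the context). Every limit point of the sequence $\{x^k\}_{k\ge0}$ generated by Algorithm 3 is a global minimizer of the problem $\min_{x\in X}(g(x)-h(x))$.
   Context: $X=\{x\in\mathbb{R}^n\mid \ell_i\le x_i\le u_i,\ i=1,\dots,n\}$ with $\ell_i<u_i$ for all $i$. For $x\in\mathbb{R}^n$, $c(x)$ denotes an (arbitrary, chosen) element of the subdifferential $\partial g(x)$, and for $x^*\in\mathbb{R}^n$, $$H(g,x^* )=\{(x,t)\in\mathbb{R}^n\times\mathbb{R}\mid t-c(x^* )^{\mathsf T}x\ge g(x^* )-c(x^* )^{\mathsf T}x^*\}.$$ $\operatorname{vert} C$ denotes the set of vertices of a polyhedral convex set $C$. A limit point of a sequence is a limit of a convergent subsequence. Algorithm 3 (input $g,h$, $X=[\ell,u]$, $\epsilon$): Set $k=0$, $x^0=\frac{\ell+u}{2}$, $\bar C^0=H(g,x^0)\cap(X\times\mathbb{R})$, $g^0(x)=g(x^0)+c(x^0)^{\mathsf T}(x-x^0)$. Repeat: increase $k$ by $1$; compute $\operatorname{vert}\bar C^{k-1}$ and choose $(x^k,y^k)\in\arg\min_{(x,y)\in\operatorname{vert}\bar C^{k-1}}(y-h(x))$. If $g(x^k)-y^k>\epsilon$, set $s^k(x)=g(x^k)+c(x^k)^{\mathsf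 T}(x-x^k)$, $g^k(x)=\max\{g^{k-1}(x),s^k(x)\}$, $\bar C^k=\bar C^{k-1}\cap H(g,x^k)$; otherwise stop and return $x^k$. *)

theory Defs
  imports "HOL-Analysis.Analysis" "HOL-Library.Extended_Nat"
begin

definition subdifferential :: "(real^'n \<Rightarrow> real) \<Rightarrow> real^'n \<Rightarrow> (real^'n) set" where
  "subdifferential g x = {v. \<forall>z. g z \<ge> g x + v \<bullet> (z - x)}"

text \<open>The argument \<open>c\<close> is the chosen selection of subgradients of \<open>g\<close>.\<close>

definition H :: "(real^'n \<Rightarrow> real) \<Rightarrow> (real^'n \<Rightarrow> real^'n) \<Rightarrow> real^'n \<Rightarrow> ((real^'n) \<times> real) set" where
  "H g c xs = {(x, t). t - c xs \<bullet> x \<ge> g xs - c xs \<bullet> xs}"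

definition vert :: "'a::real_vector set \<Rightarrow> 'a set" where
  "vert C = {v. v extreme_point_of C}"

text \<open>
  A complete execution of the algorithm for the box \<open>cbox l u\<close>. The number \<open>N\<close> is the
  value of the iteration counter at which it stops, with \<open>N = \<infinity>\<close> if it never stops.
  Only the following entries of the sequences are constrained: \<open>x k\<close> for \<open>0 \<le> k \<le> N\<close>,
  \<open>y k\<close> for \<open>1 \<le> k \<le> N\<close>, and the outer approximations \<open>C k\<close> and the cutting-plane
  models \<open>G k\<close> for \<open>0 \<le> k < N\<close>.
\<close>

definition algorithm_run ::
  "(real^'n \<Rightarrow> real) \<Rightarrow> (real^'n \<Rightarrow> real) \<Rightarrow> (real^'n \<Rightarrow> real^'n) \<Rightarrow> real^'n \<Rightarrow> real^'n \<Rightarrow> real \<Rightarrow>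
   enat \<Rightarrow> (nat \<Rightarrow> real^'n) \<Rightarrow> (nat \<Rightarrow> real) \<Rightarrow> (nat \<Rightarrow> ((real^'n) \<times> real) set) \<Rightarrow>
   (nat \<Rightarrow> real^'n \<Rightarrow> real) \<Rightarrow> bool" where
  "algorithm_run g h c l u \<epsilon> N x y C G \<longleftrightarrow>
     x 0 = (1/2) *\<^sub>R (l + u) \<and>
     C 0 = H g c (x 0) \<inter> (cbox l u \<times> UNIV) \<and>
     G 0 = (\<lambda>z. g (x 0) + c (x 0) \<bullet> (z - x 0)) \<and>
     N \<ge> 1 \<and>
     (\<forall>k\<ge>1. enat k \<le> N \<longrightarrow>
        is_arg_min (\<lambda>(z, t). t - h z) (\<lambda>p. p \<in> vert (C (k - 1))) (x k, y k)) \<and>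
     (\<forall>k\<ge>1. enat k < N \<longrightarrow>
        g (x k) - y k > \<epsilon> \<and>
        G k = (\<lambda>z. max (G (k - 1) z) (g (x k) + c (x k) \<bullet> (z - x k))) \<and>
        C k = C (k - 1) \<inter> H g c (x k)) \<and>
     (\<forall>k. N = enat k \<longrightarrow> g (x k) - y k \<le> \<epsilon>)"

text \<open>
  Limit point of the sequence \<open>x 0, x 1, \<dots>\<close> with last index \<open>N\<close>, as the limit of a
  convergent subsequence; for finite \<open>N\<close> there is none.
\<close>

definition seq_limit_point :: "enat \<Rightarrow> (nat \<Rightarrow> 'a::topological_space) \<Rightarrow> 'a \<Rightarrow> bool" where
  "seq_limit_point N x a \<longleftrightarrow>
     (\<exists>r. strict_mono r \<and> (\<forall>j. enat (r j) \<le> N) \<and> (x \<circ> r) \<longlonglongrightarrow> a)"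

end

theory Submission imports Defs begin

text \<open>
  A run whose iterates have a limit point never stops. Each \<open>C k\<close> is the epigraph over the box of the
  cutting-plane model \<open>G k\<close>, and \<open>G k \<le> g\<close> because every subgradient cut minorizes \<open>g\<close>.

  The vertex problem solved in an iteration is a relaxation of the original problem. The function
  \<open>(z, t) \<mapsto> t - h z\<close> is concave, and although the epigraph is unbounded, a
  lower bound at the vertices is a lower bound everywhere (\<open>vertex_bound_on_graph\<close>
  proves this on the graph): truncated above, the epigraph becomes compact, hence it is the convex
  hull of its extreme points by the theorem of Minkowski, and vertically at or below every extreme
  point of the truncation lies a genuine vertex, where the value is no larger. Therefore \<open>y k
  - h (x k) \<le> g z - h z\<close> for all \<open>z\<close> in the box.

  The relaxation becomes exact along a convergent subsequence. If \<open>j < k\<close>, then \<open>(x k, y k)\<close>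
  satisfies the cut at \<open>x j\<close>, so \<open>y k \<ge> g (x j) + c (x j) \<bullet> (x k - x j)\<close>. When \<open>x j\<close> and \<open>x k\<close> are
  consecutive members of a subsequence converging to \<open>xlim\<close>, the right-hand side has lower bounds
  that converge to \<open>g xlim\<close> (\<open>subgradient_reflection\<close>). Passing to the limit in
  the bound of the relaxation yields \<open>g xlim - h xlim \<le> g z - h z\<close>, because convex
  functions on the whole space are continuous.
\<close>

section \<open>Concave functions on epigraphs\<close>

text \<open>
  A proper convex combination of \<open>(a, \<alpha>)\<close> and \<open>(b, \<beta>)\<close> that gives \<open>(w, G w)\<close> forces both end points
  onto the graph of \<open>G\<close>. Moving the two end points and \<open>(w, G w)\<close> upwards by the same fraction of
  their distance to the level \<open>T\<close> preserves the convex combination, and the right fraction takes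
  \<open>(w, G w)\<close> to \<open>(w, s)\<close>, which would then not be extreme in the truncated epigraph.
\<close>

lemma extreme_point_below_truncation:
  fixes G :: "'a::real_vector \<Rightarrow> real"
  assumes G: "convex_on X G" and T: "\<And>z. z \<in> X \<Longrightarrow> G z \<le> T"
    and ext: "(w, s) extreme_point_of (epigraph X G \<inter> {p. snd p \<le> T})"
  shows "(w, G w) extreme_point_of (epigraph X G)"
  unfolding extreme_point_of_def
proof (intro conjI ballI notI)
  have w: "w \<in> X" "G w \<le> s" "s \<le> T"
    using ext by (auto simp: extreme_point_of_def epigraph_def)
  show "(w, G w) \<in> epigraph X G"
    using w by (simp add: epigraph_def)
  fix p q assume pq: "p \<in> epigraph X G" "q \<in> epigraph X G" and seg: "(w, G w) \<in> open_segment p q"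
  obtain a \<alpha> b \<beta> where p: "p = (a, \<alpha>)" and q: "q = (b, \<beta>)"
    by (cases p, cases q) auto
  have ab: "a \<in> X" "G a \<le> \<alpha>" "b \<in> X" "G b \<le> \<beta>"
    using pq by (auto simp: p q epigraph_def)
  obtain v where v: "0 < v" "v < 1" and ne: "(a, \<alpha>) \<noteq> (b, \<beta>)"
    and w_eq: "w = (1 - v) *\<^sub>R a + v *\<^sub>R b" and Gw_eq: "G w = (1 - v) * \<alpha> + v * \<beta>"
    using seg by (auto simp: p q in_segment)
  have conv: "G w \<le> (1 - v) * G a + v * G b"
    using convex_onD[OF G, of v a b] v ab w_eq by simp
  have mono: "(1 - v) * G a \<le> (1 - v) * \<alpha>" "v * G b \<le> v * \<beta>"
    using v ab by simp_all
  have "(1 - v) * \<alpha> = (1 - v) * G a" "v * \<beta> = v * G b"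
    using conv mono Gw_eq by linarith+
  then have graph: "\<alpha> = G a" "\<beta> = G b"
    using v by simp_all
  with ne have "a \<noteq> b"
    by auto
  \<comment> \<open>If \<open>G w = T\<close>, then also \<open>s = T\<close>, and any fraction will do.\<close>
  obtain \<mu> where \<mu>: "0 \<le> \<mu>" "\<mu> \<le> 1" and s_eq: "s = G w + \<mu> * (T - G w)"
  proof (cases "G w < T")
    case True
    show ?thesis
      by (rule that[of "(s - G w) / (T - G w)"]) (use True w in auto)
  next
    case False
    show ?thesis
      by (rule that[of 0]) (use False w in auto)
  qed
  define up where "up z = G z + \<mu> * (T - G z)" for z
  have up_mem: "(z, up z) \<in> epigraph X G \<inter> {p. snd p \<le> T}" if "z \<in> X" for z
  proof -
    have "0 \<le> \<mu> * (T - G z)" "\<mu> * (T - G z) \<le> 1 * (T - G z)"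
      using T[OF that] \<mu> by (intro mult_nonneg_nonneg mult_right_mono; simp)+
    then show ?thesis
      using that by (simp add: up_def epigraph_def)
  qed
  have "s = (1 - v) * up a + v * up b"
    unfolding s_eq up_def Gw_eq graph by (simp add: algebra_simps)
  then have "(w, s) \<in> open_segment (a, up a) (b, up b)"
    using v w_eq \<open>a \<noteq> b\<close> by (auto simp: in_segment)
  then show False
    using ext up_mem ab by (auto simp: extreme_point_of_def)
qed

text \<open>
  The points where the concave function \<open>(z, t) \<mapsto> t - h z\<close> is at least \<open>m\<close> form a convex set, so it
  suffices that this set contains the extreme points of the truncated epigraph. The truncation level
  is an upper bound of \<open>G\<close>, so that the truncated epigraph still contains the whole graph.
\<close>

lemma vertex_bound_on_graph:
  fixes G h :: "'a::euclidean_space \<Rightarrow> real"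
  assumes X: "compact X" and G: "convex_on X G" "continuous_on X G" and h: "convex_on X h"
    and m: "\<And>w t. (w, t) \<in> vert (epigraph X G) \<Longrightarrow> m \<le> t - h w"
    and z: "z \<in> X"
  shows "m \<le> G z - h z"
proof -
  have bounded_G: "bounded (G ` X)"
    using compact_continuous_image[OF G(2) X] by (rule compact_imp_bounded)
  then obtain T where T: "G z \<le> T" if "z \<in> X" for z
    using bounded_imp_bdd_above by (fastforce simp: bdd_above_def)
  define K where "K = epigraph X G \<inter> {p. snd p \<le> T}"
  have "convex K"
  proof -
    have "{p :: 'a \<times> real. snd p \<le> T} = UNIV \<times> {..T}"
      by auto
    then have "convex {p :: 'a \<times> real. snd p \<le> T}"
      by (simp add: convex_Times)
    moreover have "convex (epigraph X G)"
      using G(1) by (simp add: convex_epigraph)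
    ultimately show ?thesis
      unfolding K_def by (simp add: convex_Int)
  qed
  have "compact K"
  proof -
    obtain B where B: "B \<le> G z" if "z \<in> X" for z
      using bounded_imp_bdd_below[OF bounded_G] by (fastforce simp: bdd_below_def)
    have "continuous_on (X \<times> {B..T}) (\<lambda>p. G (fst p))"
      by (intro continuous_on_compose2[OF G(2)] continuous_intros) auto
    then have "closed {p \<in> X \<times> {B..T}. G (fst p) \<le> snd p}"
      using X by (intro continuous_on_closed_Collect_le continuous_intros closed_Times
          compact_imp_closed) auto
    moreover have "{p \<in> X \<times> {B..T}. G (fst p) \<le> snd p} = K"
      using B by (force simp: K_def epigraph_def)
    moreover have "bounded K"
    proof (rule bounded_subset)
      show "bounded (X \<times> {B..T})"
        using X by (intro bounded_Times compact_imp_bounded) auto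
      show "K \<subseteq> X \<times> {B..T}"
        using B by (force simp: K_def epigraph_def)
    qed
    ultimately show ?thesis
      by (simp add: compact_eq_bounded_closed)
  qed
  define S where "S = {p \<in> X \<times> UNIV. m \<le> snd p - h (fst p)}"
  have "convex S"
  proof -
    have "S = epigraph X (\<lambda>z. h z + m)"
      by (auto simp: S_def epigraph_def)
    moreover have "convex_on X (\<lambda>z. h z + m)"
      using h by (intro convex_on_add) (auto simp: convex_on_const dest: convex_on_imp_convex)
    ultimately show ?thesis
      by (simp add: convex_epigraph)
  qed
  have "{p. p extreme_point_of K} \<subseteq> S"
  proof
    fix p assume "p \<in> {p. p extreme_point_of K}"
    moreover obtain w s where p: "p = (w, s)"
      by (cases p)
    ultimately have ext: "(w, s) extreme_point_of K"
      by simp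
    then have "w \<in> X" "G w \<le> s"
      by (auto simp: extreme_point_of_def K_def epigraph_def)
    moreover have "m \<le> G w - h w"
      using extreme_point_below_truncation[OF G(1) T ext[unfolded K_def]] m by (simp add: vert_def)
    ultimately show "p \<in> S"
      by (simp add: p S_def)
  qed
  then have "convex hull {p. p extreme_point_of K} \<subseteq> S"
    using \<open>convex S\<close> by (rule hull_minimal)
  then have "K \<subseteq> S"
    using Krein_Milman_Minkowski[OF \<open>compact K\<close> \<open>convex K\<close>] by simp
  moreover have "(z, G z) \<in> K"
    using z T by (simp add: K_def epigraph_def)
  ultimately show ?thesis
    by (auto simp: S_def)
qed

section \<open>Cutting planes\<close>

text \<open>
  The reflection \<open>2 *\<^sub>R a - b\<close> of \<open>b\<close> at \<open>a\<close> turns an upper bound of the cut into a lower bound. Near a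
  point of continuity of \<open>g\<close> this bounds the cut from below without a bound on the subgradients.
\<close>

lemma subgradient_reflection:
  assumes "v \<in> subdifferential g a"
  shows "2 * g a - g (2 *\<^sub>R a - b) \<le> g a + v \<bullet> (b - a)"
proof -
  have "g a + v \<bullet> ((2 *\<^sub>R a - b) - a) \<le> g (2 *\<^sub>R a - b)"
    using assms by (simp add: subdifferential_def)
  moreover have "(2 *\<^sub>R a - b) - a = - (b - a)"
    by (simp add: scaleR_2)
  ultimately show ?thesis
    by (simp only: inner_minus_right)
qed

lemma convex_on_cut:
  fixes v :: "'a::real_inner"
  shows "convex_on UNIV (\<lambda>z. \<gamma> + v \<bullet> (z - a))"
  by (rule convex_onI) (auto simp: algebra_simps inner_simps)

lemma convex_on_max:
  fixes f1 f2 :: "'a::real_vector \<Rightarrow> real"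
  assumes "convex_on S f1" "convex_on S f2"
  shows "convex_on S (\<lambda>z. max (f1 z) (f2 z))"
proof -
  have "epigraph S (\<lambda>z. max (f1 z) (f2 z)) = epigraph S f1 \<inter> epigraph S f2"
    by (auto simp: epigraph_def)
  then show ?thesis
    using assms by (metis convex_Int convex_epigraph)
qed

lemma mem_H_iff: "(z, t) \<in> H g c a \<longleftrightarrow> g a + c a \<bullet> (z - a) \<le> t"
  by (auto simp: H_def inner_diff_right)

lemma algorithm_run_models:
  assumes run: "algorithm_run g h c l u 0 \<infinity> x y C G" and c: "\<And>z. c z \<in> subdifferential g z"
  shows "C k = epigraph (cbox l u) (G k)"
    and "convex_on UNIV (G k)"
    and "G k z \<le> g z"
    and "j \<le> k \<Longrightarrow> g (x j) + c (x j) \<bullet> (z - x j) \<le> G k z"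
proof -
  have sub: "g a + c a \<bullet> (z - a) \<le> g z" for a z
    using c[of a] by (simp add: subdifferential_def)
  have C0: "C 0 = H g c (x 0) \<inter> (cbox l u \<times> UNIV)"
    and G0: "G 0 = (\<lambda>z. g (x 0) + c (x 0) \<bullet> (z - x 0))"
    using run by (simp_all add: algorithm_run_def)
  have step: "G (Suc k) = (\<lambda>z. max (G k z) (g (x (Suc k)) + c (x (Suc k)) \<bullet> (z - x (Suc k)))) \<and>
      C (Suc k) = C k \<inter> H g c (x (Suc k))" for k
  proof -
    have "\<forall>k\<ge>1. G k = (\<lambda>z. max (G (k - 1) z) (g (x k) + c (x k) \<bullet> (z - x k))) \<and>
        C k = C (k - 1) \<inter> H g c (x k)"
      using run by (simp add: algorithm_run_def)
    from this[rule_format, of "Suc k"] show ?thesis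
      by simp
  qed
  show "C k = epigraph (cbox l u) (G k)"
  proof (induction k)
    case 0
    show ?case
      by (auto simp: C0 G0 mem_H_iff epigraph_def)
  next
    case (Suc k)
    then show ?case
      using step[of k] by (auto simp: mem_H_iff epigraph_def)
  qed
  show "convex_on UNIV (G k)"
  proof (induction k)
    case 0
    show ?case
      by (simp add: G0 convex_on_cut)
  next
    case (Suc k)
    then show ?case
      using step[of k] convex_on_max[OF _ convex_on_cut] by simp
  qed
  show "G k z \<le> g z"
    by (induction k) (use sub step in \<open>auto simp: G0\<close>)
  show "g (x j) + c (x j) \<bullet> (z - x j) \<le> G k z" if "j \<le> k"
    using that by (induction k) (use step in \<open>auto simp: G0 le_Suc_eq le_max_iff_disj\<close>)
qed

section \<open>Convergence of the algorithm\<close>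

theorem theorem4p4:
  fixes g h :: "real^'n \<Rightarrow> real"
    and c :: "real^'n \<Rightarrow> real^'n"
    and l u xlim :: "real^'n"
    and N :: enat
    and x :: "nat \<Rightarrow> real^'n" and y :: "nat \<Rightarrow> real"
    and C :: "nat \<Rightarrow> ((real^'n) \<times> real) set"
    and G :: "nat \<Rightarrow> real^'n \<Rightarrow> real"
  assumes "\<And>i. l $ i < u $ i"
    and "convex_on UNIV g" and "convex_on UNIV h"
    and "\<And>z. c z \<in> subdifferential g z"
    and "algorithm_run g h c l u 0 N x y C G"
    and "seq_limit_point N x xlim"
  shows "is_arg_min (\<lambda>z. g z - h z) (\<lambda>z. z \<in> cbox l u) xlim"
proof -
  obtain r where r: "strict_mono r" "\<And>j. enat (r j) \<le> N" and lim: "(\<lambda>j. x (r j)) \<longlonglongrightarrow> xlim"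
    using assms(6) by (auto simp: seq_limit_point_def o_def)
  have "N = \<infinity>"
  proof (cases N)
    case (enat n)
    then have "r (Suc n) \<le> n"
      using r(2)[of "Suc n"] by simp
    then show ?thesis
      using strict_mono_imp_increasing[OF r(1), of "Suc n"] by simp
  qed
  with assms(5) have run: "algorithm_run g h c l u 0 \<infinity> x y C G"
    by simp
  note models = algorithm_run_models[OF run assms(4)]
  have argmin: "is_arg_min (\<lambda>(z, t). t - h z) (\<lambda>p. p \<in> vert (C k)) (x (Suc k), y (Suc k))" for k
  proof -
    have "\<forall>k\<ge>1. is_arg_min (\<lambda>(z, t). t - h z) (\<lambda>p. p \<in> vert (C (k - 1))) (x k, y k)"
      using run by (simp add: algorithm_run_def)
    from this[rule_format, of "Suc k"] show ?thesis
      by simp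
  qed
  have "(x (Suc k), y (Suc k)) \<in> C k" for k
    using argmin[of k] by (simp add: is_arg_min_def vert_def extreme_point_of_def)
  then have xy: "x (Suc k) \<in> cbox l u" "G k (x (Suc k)) \<le> y (Suc k)" for k
    by (simp_all add: models(1) epigraph_def)
  have relax: "y (Suc k) - h (x (Suc k)) \<le> g z - h z" if z: "z \<in> cbox l u" for k z
  proof -
    have "y (Suc k) - h (x (Suc k)) \<le> G k z - h z"
    proof (rule vertex_bound_on_graph[where X = "cbox l u" and G = "G k" and h = h])
      show "convex_on (cbox l u) (G k)" "convex_on (cbox l u) h"
        using convex_on_subset[OF models(2)] convex_on_subset[OF assms(3)] by auto
      show "continuous_on (cbox l u) (G k)"
        using convex_on_continuous[OF open_UNIV models(2)] by (rule continuous_on_subset) simp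
      show "y (Suc k) - h (x (Suc k)) \<le> t - h w"
        if "(w, t) \<in> vert (epigraph (cbox l u) (G k))" for w t
        using argmin[of k] that models(1)[of k] by (force simp: is_arg_min_def not_less)
    qed (use z in \<open>auto intro: compact_cbox\<close>)
    also have "\<dots> \<le> g z - h z"
      using models(3) by simp
    finally show ?thesis .
  qed
  have cut: "2 * g (x j) - g (2 *\<^sub>R x j - x k) \<le> y k" if "j < k" for j k
  proof -
    obtain i where i: "k = Suc i" "j \<le> i"
      using less_imp_Suc_add[OF \<open>j < k\<close>] by auto
    show ?thesis
      using subgradient_reflection[OF assms(4), of "x j" "x k"] models(4)[OF i(2), of "x k"]
        xy(2)[of i] i(1) by simp
  qed
  have lim': "(\<lambda>j. x (r (Suc j))) \<longlonglongrightarrow> xlim"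
    using lim by (rule LIMSEQ_Suc)
  have rSuc: "\<exists>i. r (Suc j) = Suc i" for j
    using strict_monoD[OF r(1), of j "Suc j"] by (cases "r (Suc j)") auto
  have g: "isCont g a" and h: "isCont h a" for a
    using convex_on_continuous[OF open_UNIV] assms(2,3) by (auto simp: continuous_on_eq_continuous_at)
  have "x (r (Suc j)) \<in> cbox l u" for j
    using rSuc[of j] xy(1) by auto
  then have xlim: "xlim \<in> cbox l u"
    using closed_sequentially[OF closed_cbox _ lim'] by blast
  have "g xlim - h xlim \<le> g z - h z" if z: "z \<in> cbox l u" for z
  proof -
    have "(\<lambda>j. 2 *\<^sub>R x (r j) - x (r (Suc j))) \<longlonglongrightarrow> 2 *\<^sub>R xlim - xlim"
      by (intro tendsto_intros lim lim')
    then have "(\<lambda>j. 2 *\<^sub>R x (r j) - x (r (Suc j))) \<longlonglongrightarrow> xlim"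
      by (simp add: scaleR_2)
    then have "(\<lambda>j. 2 * g (x (r j)) - g (2 *\<^sub>R x (r j) - x (r (Suc j))) - h (x (r (Suc j))))
        \<longlonglongrightarrow> 2 * g xlim - g xlim - h xlim"
      by (intro tendsto_intros isCont_tendsto_compose[OF g] isCont_tendsto_compose[OF h] lim lim')
    moreover have "2 * g (x (r j)) - g (2 *\<^sub>R x (r j) - x (r (Suc j))) - h (x (r (Suc j)))
        \<le> g z - h z" for j
    proof -
      have "2 * g (x (r j)) - g (2 *\<^sub>R x (r j) - x (r (Suc j))) \<le> y (r (Suc j))"
        using r(1) by (intro cut) (simp add: strict_mono_Suc_iff)
      moreover have "y (r (Suc j)) - h (x (r (Suc j))) \<le> g z - h z"
        using rSuc[of j] relax[OF z] by auto
      ultimately show ?thesis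
        by linarith
    qed
    ultimately have "2 * g xlim - g xlim - h xlim \<le> g z - h z"
      by (intro LIMSEQ_le_const2) auto
    then show ?thesis
      by simp
  qed
  with xlim show ?thesis
    by (simp add: is_arg_min_def not_less)
qed

end
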